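(* For every finite simple graph $G$ on $n$ vertices with minimum degree at least $2$, $\gamma_{tg}(G) \leq \frac{5}{7}n+\frac{5}{7}$.
   Context: Let $G$ be a graph without isolated vertices. A vertex is totally dominated by a set $A\subseteq V(G)$ if it has a neighbor in $A$; a totally dominating set is a set totally dominating every vertex of $G$. In the total domination game on $G$, two players, Dominator and Staller, alternately select vertices of $G$, Dominator moving first. Each selected vertex must strictly increase the number of vertices totally dominated by the set of selected vertices. The game ends when the set of selected vertices is a totally dominating set of $G$. Dominator aims to minimize the number of selected vertices at the end, Staller aims to maximize it. The game total domination number $\gamma_{tg}(G)$ is the number of selected vertices at the end of the game when Dominator starts and both players play optimally. *)

theory Defs
  imports Complex_Main "Graph_Theory.Pair_Digraph"
begin

text \<open>
  A finite simple graph is a \<^locale>\<open>pair_graph\<close>: a finite, loop-free, symmetric set of ordered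
  pairs, in which each edge occurs once in each direction.  So \<open>(u, a) \<in> parcs G\<close> says that
  \<open>a\<close> is a neighbour of \<open>u\<close>, and \<^const>\<open>out_degree\<close> is the degree.
\<close>

definition totally_dominated :: "'a pair_pre_digraph \<Rightarrow> 'a set \<Rightarrow> 'a set" where
  "totally_dominated G A = {u \<in> pverts G. \<exists>a\<in>A. (u, a) \<in> parcs G}"

definition totally_dominating :: "'a pair_pre_digraph \<Rightarrow> 'a set \<Rightarrow> bool" where
  "totally_dominating G A \<longleftrightarrow> A \<subseteq> pverts G \<and> totally_dominated G A = pverts G"

definition legal_moves :: "'a pair_pre_digraph \<Rightarrow> 'a set \<Rightarrow> 'a set" where
  "legal_moves G A = {v \<in> pverts G.
     card (totally_dominated G A) < card (totally_dominated G (insert v A))}"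

datatype player = Dominator | Staller

text \<open>
  The number of selected vertices at the end of the game under optimal play, when the set \<open>A\<close> has
  been selected so far and the given player is to move.  Finiteness is tested only to make the
  recursion terminate.  In a finite graph without isolated vertices, \<^const>\<open>Min\<close> and \<^const>\<open>Max\<close>
  are only taken of nonempty finite sets (lemma \<open>legal_moves_nonempty\<close>).
\<close>

function game_value :: "'a pair_pre_digraph \<Rightarrow> player \<Rightarrow> 'a set \<Rightarrow> nat" where
  "game_value G Dominator A =
     (if infinite (pverts G) \<or> totally_dominating G A then card A
      else Min ((\<lambda>v. game_value G Staller (insert v A)) ` legal_moves G A))"
| "game_value G Staller A =
     (if infinite (pverts G) \<or> totally_dominating G A then card A
      else Max ((\<lambda>v. game_value G Dominator (insert v A)) ` legal_moves G A))"
  by pat_completeness auto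

lemma game_value_decrease:
  assumes "finite (pverts G)" "v \<in> legal_moves G A"
  shows "card (pverts G) - card (totally_dominated G (insert v A))
       < card (pverts G) - card (totally_dominated G A)"
proof -
  have "card (totally_dominated G (insert v A)) \<le> card (pverts G)"
    using assms(1) by (intro card_mono) (auto simp: totally_dominated_def)
  then show ?thesis
    using assms(2) by (auto simp: legal_moves_def)
qed

termination
  by (relation "measure (\<lambda>(G, p, A). card (pverts G) - card (totally_dominated G A))")
     (auto intro: game_value_decrease)

declare game_value.simps [simp del]

definition game_total_domination_number :: "'a pair_pre_digraph \<Rightarrow> nat" where
  "game_total_domination_number G = game_value G Dominator {}"

lemma legal_moves_nonempty:
  assumes "pair_graph G"
    and "\<And>v. v \<in> pverts G \<Longrightarrow> out_degree (with_proj G) v \<noteq> 0"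
    and "A \<subseteq> pverts G" "\<not> totally_dominating G A"
  shows "finite (legal_moves G A)" "legal_moves G A \<noteq> {}"
proof -
  interpret pair_graph G by fact
  show "finite (legal_moves G A)"
    using pair_finite_verts by (simp add: legal_moves_def)
  obtain u where u: "u \<in> pverts G" "u \<notin> totally_dominated G A"
    using assms(3,4) by (auto simp: totally_dominating_def totally_dominated_def)
  have "out_arcs (with_proj G) u \<noteq> {}"
    using assms(2)[OF u(1)] by (auto simp: out_degree_def)
  then obtain v where v: "(u, v) \<in> parcs G"
    by (auto simp: out_arcs_def)
  have "totally_dominated G A \<subset> totally_dominated G (insert v A)"
    using u v by (auto simp: totally_dominated_def)
  then have "card (totally_dominated G A) < card (totally_dominated G (insert v A))"
    using pair_finite_verts by (intro psubset_card_mono) (auto simp: totally_dominated_def)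
  then have "v \<in> legal_moves G A"
    using in_arcsD2[OF v] by (simp add: legal_moves_def)
  then show "legal_moves G A \<noteq> {}" by blast
qed

end

theory Submission
  imports Defs
begin

text \<open>
  Write \<open>U\<close> for the set of vertices not yet totally dominated; a move \<open>v\<close> removes \<open>N v \<inter> U\<close> from
  \<open>U\<close>. Call \<open>v\<close> active if \<open>N v \<inter> U \<noteq> {}\<close>, and call \<open>u \<in> U\<close> solitary if no neighbour of \<open>u\<close> has
  another neighbour in \<open>U\<close>. The potential is three times the number of active vertices plus twice the
  number of vertices of \<open>U\<close> minus the number of solitary vertices. It starts at most at \<open>5 n\<close>, and
  Dominator makes it drop by at least 14 per pair of moves, up to a correction between 0 and 2.

  Every move costs at least 5. Dominator removes three vertices of \<open>U\<close> if he can (cost 9). Otherwise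
  he tries to remove two vertices while deactivating an additional vertex (cost 10); when
  such moves run out, Staller's last move has created a solitary vertex, which costs one more.
  Otherwise he removes a solitary vertex (cost 7), after which Staller also pays at least 7. If there
  is none, he removes any two vertices (cost 7); this is the only case in which he may fall behind, and
  he catches up when the wasteful moves it has made possible run out.
\<close>

section \<open>Positions of the game and their potential\<close>

locale min_degree_two =
  fixes V :: "'a set" and N :: "'a \<Rightarrow> 'a set"
  assumes finite_V: "finite V"
    and N_subset: "N v \<subseteq> V"
    and N_sym: "u \<in> N v \<Longrightarrow> v \<in> N u"
    and degree: "u \<in> V \<Longrightarrow> 2 \<le> card (N u)"
begin

definition active :: "'a set \<Rightarrow> 'a set" where
  "active U = {v. N v \<inter> U \<noteq> {}}"

definition solitary :: "'a set \<Rightarrow> 'a set" where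
  "solitary U = {u \<in> U. \<forall>v\<in>N u. N v \<inter> U = {u}}"

definition potential :: "'a set \<Rightarrow> int" where
  "potential U = 3 * int (card (active U)) + 2 * int (card U) - int (card (solitary U))"

text \<open>When no move removes more than two vertices, the sets \<open>N v \<inter> U\<close> are
  the edges and loops of a multigraph on \<open>U\<close>. Wasteful then means that some edge has a
  parallel copy or a loop at one of its ends; the solitary vertices are those that carry loops
  only.\<close>

definition wasteful :: "'a set \<Rightarrow> bool" where
  "wasteful U \<longleftrightarrow> (\<exists>v w. v \<noteq> w \<and> card (N v \<inter> U) = 2 \<and> w \<in> active U \<and> N w \<inter> U \<subseteq> N v)"

text \<open>The slack by which seven times the number of remaining moves may exceed the potential
  when Dominator is to move. In the last two cases it is at most the number of solitary vertices as
  soon as there is one, so newly created solitary vertices pay for it.\<close>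

definition correction :: "'a set \<Rightarrow> int" where
  "correction U =
     (if \<exists>v. 3 \<le> card (N v \<inter> U) then 2
      else if wasteful U then 0
      else if card (solitary U) = 1 then 1 else 2)"

lemma finite_N: "finite (N v)"
  using finite_V N_subset finite_subset by blast

lemma active_subset: "active U \<subseteq> V"
  using N_subset N_sym unfolding active_def by blast

lemma finite_active: "finite (active U)"
  using active_subset finite_V finite_subset by blast

lemma finite_solitary: "U \<subseteq> V \<Longrightarrow> finite (solitary U)"
  by (rule finite_subset[OF _ finite_V]) (auto simp: solitary_def)

lemma correction_bounds: "0 \<le> correction U" "correction U \<le> 2"
  by (auto simp: correction_def)

section \<open>Potential lost in a single move\<close>

lemma card_drop:
  assumes "U \<subseteq> V"
  shows "card (U - N w) + card (N w \<inter> U) = card U"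
proof -
  have "finite U" using assms finite_V finite_subset by blast
  then have "card ((U - N w) \<union> (N w \<inter> U)) = card (U - N w) + card (N w \<inter> U)"
    by (intro card_Un_disjoint) auto
  moreover have "(U - N w) \<union> (N w \<inter> U) = U" by blast
  ultimately show ?thesis by simp
qed

text \<open>\<open>D\<close> will be the played vertex alone, that vertex with a second one made
  useless, or the whole neighbourhood of a solitary vertex.\<close>

lemma active_drop:
  assumes "D \<subseteq> active U" "\<And>v. v \<in> D \<Longrightarrow> N v \<inter> U \<subseteq> N w"
  shows "card (active (U - N w)) + card D \<le> card (active U)"
proof -
  have "card (active (U - N w) \<union> D) \<le> card (active U)"
    using assms by (intro card_mono finite_active) (auto simp: active_def)
  moreover have "active (U - N w) \<inter> D = {}"
    using assms(2) by (auto simp: active_def)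
  ultimately show ?thesis
    using card_Un_disjoint[OF finite_active finite_subset[OF assms(1) finite_active]] by metis
qed

lemma active_drop_one:
  assumes "w \<in> active U"
  shows "card (active (U - N w)) + 1 \<le> card (active U)"
  using active_drop[of "{w}" U w] assms by auto

lemma solitary_Diff: "solitary U - N w \<subseteq> solitary (U - N w)"
proof
  fix x assume x: "x \<in> solitary U - N w"
  then have "N v \<inter> (U - N w) = {x}" if "v \<in> N x" for v
    using that unfolding solitary_def by blast
  then show "x \<in> solitary (U - N w)" using x by (simp add: solitary_def)
qed

lemma solitary_neighbour:
  assumes "u \<in> solitary U" "u \<in> N w"
  shows "N w \<inter> U = {u}"
  using assms N_sym[of u w] by (simp add: solitary_def)

text \<open>A move reaching a solitary vertex removes nothing else, and a solitary vertex stays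
  solitary until it is removed.\<close>

lemma solitary_mono:
  assumes "\<And>u. N w \<inter> U = {u} \<Longrightarrow> u \<notin> solitary U"
  shows "solitary U \<subseteq> solitary (U - N w)"
proof
  fix u assume u: "u \<in> solitary U"
  then have "u \<notin> N w" using assms[of u] solitary_neighbour[of u U w] by blast
  then show "u \<in> solitary (U - N w)" using u solitary_Diff[of U w] by blast
qed

lemma solitary_mono_card:
  assumes "U \<subseteq> V" "\<And>u. N w \<inter> U = {u} \<Longrightarrow> u \<notin> solitary U"
  shows "card (solitary U) \<le> card (solitary (U - N w))"
  using assms by (intro card_mono finite_solitary solitary_mono) auto

lemma potential_drop_multiple:
  assumes "U \<subseteq> V" "2 \<le> card (N w \<inter> U)" "D \<subseteq> active U" "\<And>v. v \<in> D \<Longrightarrow> N v \<inter> U \<subseteq> N w"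
  shows "potential (U - N w) + 3 * int (card D) + 2 * int (card (N w \<inter> U))
           + int (card (solitary (U - N w))) - int (card (solitary U)) \<le> potential U"
    and "card (solitary U) \<le> card (solitary (U - N w))"
proof -
  show "card (solitary U) \<le> card (solitary (U - N w))"
    using assms(2) by (intro solitary_mono_card[OF assms(1)]) auto
  show "potential (U - N w) + 3 * int (card D) + 2 * int (card (N w \<inter> U))
           + int (card (solitary (U - N w))) - int (card (solitary U)) \<le> potential U"
    using card_drop[OF assms(1), of w] active_drop[OF assms(3,4)] by (simp add: potential_def)
qed

text \<open>All neighbours of \<open>u\<close>, at least two, become inactive, \<open>u\<close>
  leaves \<open>U\<close>, and one solitary vertex is lost: 3 * 2 + 2 - 1 = 7. No vertex becomes
  solitary, because a move that sees \<open>u\<close> sees nothing else in \<open>U\<close>.\<close>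

lemma potential_drop_solitary:
  assumes "U \<subseteq> V" "u \<in> solitary U" "w \<in> N u"
  shows "potential (U - N w) + 7 \<le> potential U" and "solitary (U - N w) = solitary U - {u}"
proof -
  have w: "N w \<inter> U = {u}" using assms by (auto simp: solitary_def)
  have "u \<in> V" using assms by (auto simp: solitary_def)
  have a: "card (active (U - N w)) + card (N u) \<le> card (active U)"
    using assms(2) w by (intro active_drop) (auto simp: solitary_def active_def)
  have "x \<in> solitary U" if x: "x \<in> solitary (U - N w)" for x
  proof -
    have "N v \<inter> U = {x}" if v: "v \<in> N x" for v
    proof -
      have xv: "N v \<inter> (U - N w) = {x}" using x v by (simp add: solitary_def)
      have "u \<notin> N v"
      proof
        assume "u \<in> N v"
        then have "N v \<inter> U = {u}" by (rule solitary_neighbour[OF assms(2)])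
        then show False using xv w by blast
      qed
      moreover have "N v \<inter> (U - N w) = N v \<inter> U - N w \<inter> U" by blast
      ultimately have "N v \<inter> (U - N w) = N v \<inter> U" using w by simp
      then show ?thesis using xv by simp
    qed
    then show ?thesis using x by (simp add: solitary_def)
  qed
  then show s: "solitary (U - N w) = solitary U - {u}"
    using solitary_Diff[of U w] w by (auto simp: solitary_def)
  have "card (solitary U) = card (solitary (U - N w)) + 1"
    using card.remove[OF finite_solitary[OF assms(1)] assms(2)] by (simp add: s)
  then show "potential (U - N w) + 7 \<le> potential U"
    using card_drop[OF assms(1), of w] a w degree[OF \<open>u \<in> V\<close>] by (simp add: potential_def)
qed

text \<open>Removing two vertices costs at least 3 + 2 * 2. Only the removal of a single nonsolitary
  vertex can cost less than 7; its cost keeps the solitary counts explicit, since their growth must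
  pay for the correction.\<close>

lemma potential_drop_cases:
  assumes "U \<subseteq> V" "w \<in> active U"
  obtains "potential (U - N w) + 7 \<le> potential U"
  | y where "N w \<inter> U = {y}" "y \<notin> solitary U"
      "potential (U - N w) + 5 + int (card (solitary (U - N w))) - int (card (solitary U)) \<le> potential U"
      "card (solitary U) \<le> card (solitary (U - N w))"
proof -
  have fin: "finite (N w \<inter> U)" using finite_N by blast
  have ne: "card (N w \<inter> U) \<noteq> 0" using assms(2) fin by (auto simp: active_def)
  consider "2 \<le> card (N w \<inter> U)" | "card (N w \<inter> U) = 1" using ne by linarith
  then show thesis
  proof cases
    case 1
    then have "potential (U - N w) + 7 \<le> potential U"
      using potential_drop_multiple[OF assms(1) 1, of "{w}"] assms(2) by auto
    then show thesis by (rule that(1))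
  next
    case 2
    then obtain y where y: "N w \<inter> U = {y}" by (auto simp: card_1_singleton_iff)
    show thesis
    proof (cases "y \<in> solitary U")
      case True
      then show thesis using potential_drop_solitary(1)[OF assms(1) True] y N_sym that(1) by blast
    next
      case False
      show thesis
      proof (rule that(2)[OF y False])
        show "card (solitary U) \<le> card (solitary (U - N w))"
          using y False by (intro solitary_mono_card[OF assms(1)]) auto
        show "potential (U - N w) + 5 + int (card (solitary (U - N w))) - int (card (solitary U))
                \<le> potential U"
          using card_drop[OF assms(1), of w] active_drop_one[OF assms(2)] 2
          by (simp add: potential_def)
      qed
    qed
  qed
qed

lemma potential_drop_5:
  assumes "U \<subseteq> V" "w \<in> active U"
  shows "potential (U - N w) + 5 \<le> potential U"
  using assms by (rule potential_drop_cases) linarith+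

section \<open>Positions in which no move removes more than two vertices\<close>

lemma pair_eq:
  assumes "card (N e \<inter> U) \<le> 2" "x \<in> N e \<inter> U" "y \<in> N e \<inter> U" "x \<noteq> y"
  shows "N e \<inter> U = {x, y}"
  using assms card_seteq[of "N e \<inter> U" "{x, y}"] finite_N by auto

lemma not_solitary_pair:
  assumes "\<And>v. card (N v \<inter> U) \<le> 2" "y \<in> U" "y \<notin> solitary U"
  shows "\<exists>e x. x \<noteq> y \<and> N e \<inter> U = {y, x}"
proof -
  obtain e where e: "e \<in> N y" "N e \<inter> U \<noteq> {y}" using assms(2,3) by (auto simp: solitary_def)
  have y: "y \<in> N e \<inter> U" using N_sym[OF e(1)] assms(2) by blast
  then obtain x where x: "x \<in> N e \<inter> U" "x \<noteq> y" using e(2) by blast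
  have "N e \<inter> U = {y, x}" using pair_eq[OF assms(1) y x(1)] x(2) by blast
  then show ?thesis using x(2) by blast
qed

text \<open>Otherwise \<open>x\<close> also lies on an edge with two ends, and the loop
  \<open>e\<close> at \<open>x\<close> makes the position wasteful.\<close>

lemma solitary_if_not_wasteful:
  assumes "\<And>v. card (N v \<inter> U) \<le> 2" "\<not> wasteful U" "N e \<inter> U = {x}"
  shows "x \<in> solitary U"
proof (rule ccontr)
  assume "x \<notin> solitary U"
  then obtain e' z where e': "z \<noteq> x" "N e' \<inter> U = {x, z}"
    using not_solitary_pair[OF assms(1) _ \<open>x \<notin> solitary U\<close>] assms(3) by blast
  then have "e' \<noteq> e" "card (N e' \<inter> U) = 2" "e \<in> active U" "N e \<inter> U \<subseteq> N e'"
    using assms(3) by (auto simp: active_def)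
  then show False using assms(2) unfolding wasteful_def by blast
qed

lemma card_le_2_Diff:
  assumes "\<And>v. card (N v \<inter> U) \<le> 2"
  shows "card (N v \<inter> (U - X)) \<le> 2"
proof -
  have "card (N v \<inter> (U - X)) \<le> card (N v \<inter> U)" using finite_N by (intro card_mono) auto
  then show ?thesis using assms[of v] by linarith
qed

text \<open>Before the move \<open>y\<close> lies on an edge with other end \<open>x\<close>. The
  move shrinks this edge to a loop at \<open>x\<close>; as the new position is not wasteful,
  \<open>x\<close> has become solitary, and no old solitary vertex is lost.\<close>

lemma new_solitary:
  assumes "U \<subseteq> V" "\<And>v. card (N v \<inter> U) \<le> 2" "\<not> wasteful (U - N w)"
    and "N w \<inter> U = {y}" "y \<notin> solitary U"
  shows "card (solitary U) < card (solitary (U - N w))"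
proof -
  obtain e x where e: "x \<noteq> y" "N e \<inter> U = {y, x}"
    using not_solitary_pair[OF assms(2) _ assms(5)] assms(4) by blast
  have le: "\<And>v. card (N v \<inter> (U - N w)) \<le> 2" by (rule card_le_2_Diff[OF assms(2)])
  have "N e \<inter> (U - N w) = {x}" using e assms(4) by blast
  then have "x \<in> solitary (U - N w)"
    using solitary_if_not_wasteful[OF le assms(3)] by blast
  moreover have "x \<in> N e" "N e \<inter> U \<noteq> {x}" using e by auto
  then have "x \<notin> solitary U" using solitary_neighbour by blast
  moreover have "solitary U \<subseteq> solitary (U - N w)"
    using assms(4,5) by (intro solitary_mono) auto
  ultimately show ?thesis
    using assms(1) by (intro psubset_card_mono finite_solitary) auto
qed

section \<open>Good moves for Dominator, by type of position\<close>

lemma correction_eq: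
  assumes "\<And>v. card (N v \<inter> U) \<le> 2"
  shows "correction U = (if wasteful U then 0 else if card (solitary U) = 1 then 1 else 2)"
proof -
  have "\<not> (\<exists>v. 3 \<le> card (N v \<inter> U))"
  proof
    assume "\<exists>v. 3 \<le> card (N v \<inter> U)"
    then obtain v where "3 \<le> card (N v \<inter> U)" ..
    then show False using assms[of v] by linarith
  qed
  then show ?thesis by (simp add: correction_def)
qed

text \<open>The last conjunct charges 7 to each of the two moves of a full round. The bound 7 on the
  first drop serves the case in which Dominator's move ends the game.\<close>

definition good_move :: "'a set \<Rightarrow> 'a \<Rightarrow> bool" where
  "good_move U v \<longleftrightarrow> v \<in> active U \<and> 7 \<le> potential U - potential (U - N v) \<and>
     (\<forall>w \<in> active (U - N v).
        14 + potential (U - N v - N w) + correction (U - N v - N w) \<le> potential U + correction U)"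

text \<open>The two moves cost at least 9 + 5 = 14, and the correction already has its maximal value
  2.\<close>

lemma good_move_triple:
  assumes "U \<subseteq> V" "3 \<le> card (N v \<inter> U)"
  shows "good_move U v"
proof -
  have v: "v \<in> active U" using assms(2) by (auto simp: active_def)
  have "potential (U - N v) + 9 \<le> potential U"
    using potential_drop_multiple[OF assms(1), of v "{v}"] v assms(2) by auto
  moreover have "correction U = 2" using assms(2) by (auto simp: correction_def)
  moreover have "5 + potential (U - N v - N w) + correction (U - N v - N w)
      \<le> potential (U - N v) + 2" if w: "w \<in> active (U - N v)" for w
  proof -
    have "U - N v \<subseteq> V" using assms(1) by blast
    then show ?thesis
      using potential_drop_5[OF _ w] correction_bounds(2)[of "U - N v - N w"] by simp
  qed
  ultimately show ?thesis
    using v by (fastforce simp: good_move_def)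
qed

text \<open>Here the correction is 0. Dominator's move costs 3 * 2 + 2 * 2 = 10, so Staller's has to
  cover 4 and the next correction. It costs at least 5 if the position stays wasteful, and at least
  6 otherwise, thanks to a new solitary vertex.\<close>

lemma good_move_wasteful:
  assumes "U \<subseteq> V" "\<And>v. card (N v \<inter> U) \<le> 2" "wasteful U"
  shows "\<exists>v. good_move U v"
proof -
  obtain v v' where v: "v \<noteq> v'" "card (N v \<inter> U) = 2" "v' \<in> active U" "N v' \<inter> U \<subseteq> N v"
    using assms(3) by (auto simp: wasteful_def)
  have va: "v \<in> active U" using v by (auto simp: active_def)
  have p: "potential (U - N v) + 10 \<le> potential U"
  proof -
    have "x \<in> {v, v'} \<Longrightarrow> N x \<inter> U \<subseteq> N v" for x using v(4) by auto
    then show ?thesis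
      using potential_drop_multiple[OF assms(1), of v "{v, v'}"] v va by simp
  qed
  have "4 + potential (U - N v - N w) + correction (U - N v - N w) \<le> potential (U - N v)"
    if w: "w \<in> active (U - N v)" for w
  proof -
    have sub: "U - N v \<subseteq> V" using assms(1) by blast
    have le: "\<And>x. card (N x \<inter> (U - N v)) \<le> 2" by (rule card_le_2_Diff[OF assms(2)])
    have le': "\<And>x. card (N x \<inter> (U - N v - N w)) \<le> 2" by (rule card_le_2_Diff[OF le])
    show ?thesis
    proof (cases "wasteful (U - N v - N w)")
      case True
      then show ?thesis using potential_drop_5[OF sub w] correction_eq[OF le'] by simp
    next
      case False
      from sub w have "potential (U - N v - N w) + 6 \<le> potential (U - N v)"
      proof (cases rule: potential_drop_cases)
        case (2 y)
        then show ?thesis using new_solitary[OF sub le False 2(1,2)] by linarith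
      qed linarith
      then show ?thesis using correction_bounds(2)[of "U - N v - N w"] by linarith
    qed
  qed
  moreover have "correction U = 0" using correction_eq[OF assms(2)] assms(3) by simp
  ultimately have "good_move U v" using va p unfolding good_move_def by fastforce
  then show ?thesis ..
qed

lemma good_move_solitary:
  assumes "U \<subseteq> V" "\<And>v. card (N v \<inter> U) \<le> 2" "\<not> wasteful U" "u \<in> solitary U"
  shows "\<exists>v. good_move U v"
proof -
  have "u \<in> V" using assms(1,4) by (auto simp: solitary_def)
  then obtain v where v: "v \<in> N u" using degree by fastforce
  have Nv: "N v \<inter> U = {u}" using assms(4) v by (auto simp: solitary_def)
  have va: "v \<in> active U" using Nv by (auto simp: active_def)
  note p = potential_drop_solitary[OF assms(1,4) v]
  define U' where "U' = U - N v"
  have sub: "U' \<subseteq> V" using assms(1) by (auto simp: U'_def)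
  have le: "\<And>x. card (N x \<inter> U') \<le> 2"
    unfolding U'_def by (rule card_le_2_Diff[OF assms(2)])
  have nw: "\<not> wasteful U'"
  proof
    assume "wasteful U'"
    then obtain a b where ab: "a \<noteq> b" "card (N a \<inter> U') = 2" "b \<in> active U'" "N b \<inter> U' \<subseteq> N a"
      by (auto simp: wasteful_def)
    \<comment> \<open>A move still active does not see \<open>u\<close>, so a wasteful pair in
      \<open>U'\<close> would be one in \<open>U\<close> already.\<close>
    have same: "N x \<inter> U' = N x \<inter> U" if "x \<in> active U'" for x
    proof -
      have "N x \<inter> U \<noteq> {u}" using that Nv by (auto simp: active_def U'_def)
      then have "u \<notin> N x" using solitary_neighbour[OF assms(4)] by blast
      then show ?thesis using Nv by (auto simp: U'_def)
    qed
    have "a \<in> active U'" using ab(2) by (auto simp: active_def)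
    then have "card (N a \<inter> U) = 2" "N b \<inter> U \<subseteq> N a" "b \<in> active U"
      using ab same[of a] same[of b] by (auto simp: active_def)
    then have "wasteful U" using ab(1) unfolding wasteful_def by blast
    then show False using assms(3) by blast
  qed
  have "14 + potential (U' - N w) + correction (U' - N w) \<le> potential U + correction U"
    if w: "w \<in> active U'" for w
  proof -
    have le': "\<And>x. card (N x \<inter> (U' - N w)) \<le> 2" by (rule card_le_2_Diff[OF le])
    from sub w have s7: "potential (U' - N w) + 7 \<le> potential U'"
    proof (cases rule: potential_drop_cases)
      case (2 y)
      then show ?thesis using solitary_if_not_wasteful[OF le nw 2(1)] by blast
    qed
    show ?thesis
    proof (cases "card (solitary U) = 1")
      case False
      then show ?thesis
        using s7 p(1) correction_bounds(2)[of "U' - N w"] correction_eq[OF assms(2)] assms(3)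
        by (simp add: U'_def)
    next
      case True
      then have "solitary U = {u}" using assms(4) by (auto simp: card_1_singleton_iff)
      then have s': "solitary U' = {}" using p(2) by (simp add: U'_def)
      have c: "correction U = 1" using correction_eq[OF assms(2)] assms(3) True by simp
      \<comment> \<open>The current correction is only 1, so Staller's move must cover 14 - 7 - 1 =
        6 and the next correction. A cost of 7 suffices unless that correction is 2.\<close>
      have "potential (U' - N w) + correction (U' - N w) + 6 \<le> potential U'"
      proof (cases "wasteful (U' - N w) \<or> card (solitary (U' - N w)) = 1")
        case True
        then show ?thesis using s7 correction_eq[OF le'] by auto
      next
        case False
        have "N w \<inter> U' \<noteq> {}" using w by (auto simp: active_def)
        \<comment> \<open>No solitary vertex is left, so Staller must remove a pair.\<close>
        moreover have "N w \<inter> U' \<noteq> {x}" for x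
          using solitary_if_not_wasteful[OF le nw, of w x] s' by blast
        ultimately obtain q r where qr: "q \<in> N w \<inter> U'" "r \<in> N w \<inter> U'" "q \<noteq> r" by blast
        then have Nw: "N w \<inter> U' = {q, r}" using pair_eq[OF le] by blast
        then have card2: "card (N w \<inter> U') = 2" using qr by simp
        have "q \<in> V" using qr sub by blast
        \<comment> \<open>A second edge \<open>e\<close> at \<open>q\<close> has an end
          \<open>x\<close> outside the pair, since \<open>U'\<close> is not wasteful. After
          Staller's move \<open>e\<close> is a loop and \<open>x\<close> is solitary. The solitary
          count is thus positive and not 1, so the move costs at least 3 + 4 + 2.\<close>
        then obtain e where e: "e \<in> N q" "e \<noteq> w"
          using degree[of q] by (metis card_le_Suc0_iff_eq finite_N not_less_eq_eq numeral_2_eq_2)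
        have qe: "q \<in> N e \<inter> U'" using e N_sym qr by blast
        obtain x where x: "x \<in> N e \<inter> U'" "x \<notin> N w"
        proof (rule ccontr)
          assume "\<not> thesis"
          then have "N e \<inter> U' \<subseteq> N w" using that by blast
          then have "wasteful U'"
            unfolding wasteful_def using e card2 qe by (intro exI[of _ w] exI[of _ e]) (auto simp: active_def)
          then show False using nw by blast
        qed
        then have "N e \<inter> U' = {q, x}" using pair_eq[OF le qe, of x] qr by blast
        moreover have "N e \<inter> (U' - N w) = N e \<inter> U' - N w" by blast
        ultimately have "N e \<inter> (U' - N w) = {x}" using x qr by auto
        then have "x \<in> solitary (U' - N w)"
          using solitary_if_not_wasteful[OF le'] False by blast
        moreover have "finite (solitary (U' - N w))" using sub by (intro finite_solitary) auto
        ultimately have "card (solitary (U' - N w)) \<noteq> 0" by auto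
        then have "2 \<le> card (solitary (U' - N w))" using False by linarith
        then show ?thesis
          using potential_drop_multiple(1)[OF sub, of w "{w}"] w card2 s'
            correction_bounds(2)[of "U' - N w"] by simp
      qed
      then show ?thesis using p(1) c by (simp add: U'_def)
    qed
  qed
  then have "good_move U v" using va p(1) by (auto simp: good_move_def U'_def)
  then show ?thesis ..
qed

text \<open>The correction is 2, so the round must cover 12 and the next correction. If Staller pays
  only 5, the total is 12 plus the final number of solitary vertices. That number bounds the next
  correction, which is 0 if the position has become wasteful and otherwise is matched by a new
  solitary vertex.\<close>

lemma good_move_no_solitary:
  assumes "U \<subseteq> V" "\<And>v. card (N v \<inter> U) \<le> 2" "\<not> wasteful U" "solitary U = {}" "U \<noteq> {}"
  shows "\<exists>v. good_move U v"
proof -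
  obtain y where "y \<in> U" using assms(5) by blast
  then obtain v x where v: "x \<noteq> y" "N v \<inter> U = {y, x}"
    using not_solitary_pair[OF assms(2) \<open>y \<in> U\<close>] assms(4) by blast
  have va: "v \<in> active U" using v by (auto simp: active_def)
  define U' where "U' = U - N v"
  have p: "potential U' + 7 + int (card (solitary U')) \<le> potential U"
  proof -
    have "y \<in> N v \<and> x \<in> N v" using v(2) by blast
    then show ?thesis
      using potential_drop_multiple(1)[OF assms(1), of v "{v}"] v va assms(4) by (simp add: U'_def)
  qed
  have sub: "U' \<subseteq> V" using assms(1) by (auto simp: U'_def)
  have le: "\<And>x. card (N x \<inter> U') \<le> 2"
    unfolding U'_def by (rule card_le_2_Diff[OF assms(2)])
  have c: "correction U = 2" using correction_eq[OF assms(2)] assms(3,4) by simp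
  have "12 + potential (U' - N w) + correction (U' - N w) \<le> potential U"
    if w: "w \<in> active U'" for w
  proof -
    have le': "\<And>x. card (N x \<inter> (U' - N w)) \<le> 2" by (rule card_le_2_Diff[OF le])
    from sub w show ?thesis
    proof (cases rule: potential_drop_cases)
      case 1
      then show ?thesis using p correction_bounds(2)[of "U' - N w"] by linarith
    next
      case (2 z)
      show ?thesis
      proof (cases "wasteful (U' - N w)")
        case True
        then show ?thesis using p 2 correction_eq[OF le'] by simp
      next
        case False
        then have "card (solitary U') < card (solitary (U' - N w))"
          using new_solitary[OF sub le False 2(1,2)] by blast
        then show ?thesis using p 2 correction_eq[OF le'] False by (auto split: if_splits)
      qed
    qed
  qed
  then have "good_move U v" using va p c by (fastforce simp: good_move_def U'_def)
  then show ?thesis ..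
qed

lemma good_move_exists:
  assumes "U \<subseteq> V" "U \<noteq> {}"
  shows "\<exists>v. good_move U v"
proof (cases "\<exists>v. 3 \<le> card (N v \<inter> U)")
  case True
  then show ?thesis using good_move_triple[OF assms(1)] by blast
next
  case False
  then have le: "card (N v \<inter> U) \<le> 2" for v by (auto simp: not_le dest!: spec[of _ v])
  show ?thesis
    using good_move_wasteful[OF assms(1) le] good_move_solitary[OF assms(1) le]
      good_move_no_solitary[OF assms(1) le _ _ assms(2)] by blast
qed

end

section \<open>From the potential to the value of the game\<close>

lemma game_value_le_potential:
  fixes G :: "'a pair_pre_digraph"
  defines "N \<equiv> \<lambda>v. {u. (v, u) \<in> parcs G}"
  assumes "pair_graph G" "min_degree_two (pverts G) N" "A \<subseteq> pverts G"
    and "U = pverts G - totally_dominated G A"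
  shows "7 * int (game_value G Dominator A) \<le>
    7 * int (card A) + min_degree_two.potential N U + min_degree_two.correction N U"
  using assms(4,5)
\<comment> \<open>Each induction step treats a full round, a good move of Dominator and an optimal
  reply of Staller.\<close>
proof (induction "card U" arbitrary: A U rule: less_induct)
  case less
  interpret pair_graph G by fact
  interpret min_degree_two "pverts G" N by fact
  have dominated_insert: "pverts G - totally_dominated G (insert v B) = pverts G - totally_dominated G B - N v" for v B
    using N_sym by (auto simp: totally_dominated_def N_def)
  have dominating_iff: "totally_dominating G B \<longleftrightarrow> pverts G - totally_dominated G B = {}"
    if "B \<subseteq> pverts G" for B
    using that by (auto simp: totally_dominating_def totally_dominated_def)
  have legal_iff: "legal_moves G B = active (pverts G - totally_dominated G B)" for B
  proof -
    have "totally_dominated G B \<subseteq> totally_dominated G (insert v B)" for v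
      by (auto simp: totally_dominated_def)
    then have "card (totally_dominated G B) < card (totally_dominated G (insert v B)) \<longleftrightarrow>
        totally_dominated G B \<noteq> totally_dominated G (insert v B)" for v
      using psubset_card_mono[of "totally_dominated G (insert v B)" "totally_dominated G B"] pair_finite_verts
      by (auto simp: totally_dominated_def)
    moreover have "totally_dominated G B \<noteq> totally_dominated G (insert v B) \<longleftrightarrow>
        N v \<inter> (pverts G - totally_dominated G B) \<noteq> {}" for v
      using N_sym N_subset by (fastforce simp: totally_dominated_def N_def)
    ultimately show ?thesis
      using active_subset[of "pverts G - totally_dominated G B"] by (auto simp: legal_moves_def active_def)
  qed
  have U: "U \<subseteq> pverts G" using less.prems(2) by blast
  show ?case
  proof (cases "U = {}")
    case True
    then have "totally_dominating G A" using dominating_iff less.prems by blast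
    then show ?thesis
      using correction_bounds(1)[of U] True
      by (simp add: game_value.simps potential_def active_def solitary_def)
  next
    case False
    obtain v where v: "good_move U v" using good_move_exists[OF U False] by blast
    then have va: "v \<in> active U" by (simp add: good_move_def)
    define A1 where "A1 = insert v A"
    have A1: "A1 \<subseteq> pverts G" using va active_subset less.prems by (auto simp: A1_def)
    have U1: "pverts G - totally_dominated G A1 = U - N v"
      using dominated_insert less.prems by (simp add: A1_def)
    have fin: "finite (legal_moves G B)" for B using legal_iff finite_active by simp
    have cA1: "card A1 \<le> card A + 1"
      using finite_subset[OF less.prems(1) pair_finite_verts] by (simp add: A1_def card_insert_if)
    have "game_value G Dominator A = Min ((\<lambda>v. game_value G Staller (insert v A)) ` legal_moves G A)"
      using dominating_iff less.prems False pair_finite_verts by (simp add: game_value.simps(1))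
    also have "\<dots> \<le> game_value G Staller A1"
      using va fin legal_iff less.prems by (auto simp: A1_def intro!: Min_le)
    finally have le: "game_value G Dominator A \<le> game_value G Staller A1" .
    show ?thesis
    proof (cases "U - N v = {}")
      case True
      then have "game_value G Staller A1 = card A1"
        using dominating_iff[OF A1] U1 by (simp add: game_value.simps(2))
      \<comment> \<open>The game ends after an odd number of moves; the empty position has potential
        0, so the drop of 7 is all of \<open>potential U\<close>.\<close>
      moreover have "7 \<le> potential U"
        using v True by (simp add: good_move_def potential_def active_def solitary_def)
      ultimately show ?thesis using le cA1 correction_bounds(1)[of U] by simp
    next
      case ne: False
      have nonempty: "active (U - N v) \<noteq> {}"
      proof -
        obtain u where u: "u \<in> U - N v" using ne by blast
        then obtain w where "w \<in> N u" using degree[of u] U by fastforce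
        then show ?thesis using u N_sym by (auto simp: active_def)
      qed
      have "game_value G Staller A1 = Max ((\<lambda>v. game_value G Dominator (insert v A1)) ` active (U - N v))"
        using dominating_iff[OF A1] U1 ne pair_finite_verts legal_iff by (simp add: game_value.simps(2))
      moreover have "Max ((\<lambda>v. game_value G Dominator (insert v A1)) ` active (U - N v))
          \<in> (\<lambda>v. game_value G Dominator (insert v A1)) ` active (U - N v)"
        using finite_active nonempty by (intro Max_in) auto
      ultimately obtain w where w: "w \<in> active (U - N v)"
        and eq: "game_value G Staller A1 = game_value G Dominator (insert w A1)" by auto
      have sub: "insert w A1 \<subseteq> pverts G" using A1 w active_subset by blast
      have fU: "finite U" using U pair_finite_verts finite_subset by blast
      have "card (U - N v - N w) < card U"
        using va fU by (intro psubset_card_mono) (auto simp: active_def)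
      moreover have "U - N v - N w = pverts G - totally_dominated G (insert w A1)"
        using dominated_insert U1 by simp
      ultimately have "7 * int (game_value G Dominator (insert w A1)) \<le>
          7 * int (card (insert w A1)) + potential (U - N v - N w) + correction (U - N v - N w)"
        using less.hyps sub by blast
      moreover have "card (insert w A1) \<le> card A + 2"
        using cA1 finite_subset[OF A1 pair_finite_verts] by (simp add: card_insert_if)
      moreover have "14 + potential (U - N v - N w) + correction (U - N v - N w)
          \<le> potential U + correction U"
        using v w by (simp add: good_move_def)
      ultimately show ?thesis using le eq by linarith
    qed
  qed
qed

theorem theorem1p3:
  fixes G :: "'a pair_pre_digraph" and n :: nat
  assumes "pair_graph G"
    and "card (pverts G) = n"
    and "\<forall>v\<in>pverts G. out_degree (with_proj G) v \<ge> 2"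
  shows "real (game_total_domination_number G) \<le> 5 / 7 * real n + 5 / 7"
proof -
  interpret pair_graph G by fact
  define N where "N = (\<lambda>v. {u. (v, u) \<in> parcs G})"
  have degree_eq: "out_degree (with_proj G) v = card (N v)" for v
  proof -
    have "out_arcs (with_proj G) v = Pair v ` N v"
      by (auto simp: out_arcs_def N_def)
    then show ?thesis by (simp add: out_degree_def card_image inj_on_def)
  qed
  have loc: "min_degree_two (pverts G) N"
  proof
    show "finite (pverts G)" by (rule pair_finite_verts)
    show "N v \<subseteq> pverts G" for v using in_arcsD2 by (auto simp: N_def)
    show "v \<in> N u" if "u \<in> N v" for u v
      using that arcs_symmetric by (auto simp: N_def)
    show "2 \<le> card (N u)" if "u \<in> pverts G" for u
      using that assms(3) degree_eq by simp
  qed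
  interpret min_degree_two "pverts G" N by (rule loc)
  have "totally_dominated G {} = {}" by (simp add: totally_dominated_def)
  then have "7 * int (game_value G Dominator {}) \<le> potential (pverts G) + correction (pverts G)"
    using game_value_le_potential[OF assms(1) loc[unfolded N_def], of "{}"] by (simp add: N_def)
  moreover have "card (active (pverts G)) \<le> n"
    using card_mono[OF finite_V active_subset] assms(2) by blast
  \<comment> \<open>Initially there are at most \<open>n\<close> active and exactly \<open>n\<close>
    undominated vertices, giving potential at most 3 * n + 2 * n. The additive 2 bounds the
    correction.\<close>
  ultimately have "7 * int (game_value G Dominator {}) \<le> 5 * int n + 2"
    using correction_bounds(2)[of "pverts G"] assms(2) by (simp add: potential_def)
  then show ?thesis by (simp add: game_total_domination_number_def)
qed

end
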